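(* Let $G\sim\mathrm{ER}(n,p)$, let $\varepsilon\in[0,1/2)$, let $d=(n-1)p$, and let $\delta>0$. If $$\frac{d}{\log n}\ \ge\ (1+\delta)\left(\frac{4}{(1-2\varepsilon)^2}+\frac{4}{3(1-2\varepsilon)}\right),$$ then with probability at least $1-n^{-\delta}$ the semidefinite program $$\max\ \operatorname{Tr}(WX)\quad\text{s.t.}\quad X\succeq0,\ X_{ii}=1\ \forall i$$ has $gg^T$ as its unique optimal solution, where $g_i=(-1)^{x_i}$ (so $x$ is recovered up to global flip). When $\varepsilon\to1/2$ the condition is equivalent to $\frac{d}{\log n}\ge\frac{4(1+\delta)}{(1-2\varepsilon)^2}+o\!\left(\frac{1}{(1-2\varepsilon)^2}\right)$.
   Context: Model: $G=(V,E)$ with $V=[n]$ drawn from $\mathrm{ER}(n,p)$ (each edge present independently with probability $p$); unknown $x\in\{0,1\}^n$; for each edge $(i,j)$ one observes $Y_{(i,j)}=x_i\oplus x_j\oplus Z_{(i,j)}$ (mod 2) with $Z_{(i,j)}$ i.i.d. Bernoulli$(\varepsilon)$ independent of $G$. $W\in\mathbb{R}^{n\times n}$ is defined by $W(i,j)=(-1)^{Y_{(i,j)}}$ if $(i,j)\in E$ and $W(i,j)=0$ otherwise. Logarithms are natural. *)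

theory Defs
  imports "HOL-Probability.Probability"
begin

(* Vertices are 0..<n. Unordered pairs {i,j} are represented as (i,j) with i < j. *)
definition vpairs :: "nat \<Rightarrow> (nat \<times> nat) set" where
  "vpairs n = {(i, j). i < j \<and> j < n}"

(* Sample space: for each unordered pair, (edge present?, noise bit Z). *)
type_synonym sample = "nat \<times> nat \<Rightarrow> bool \<times> bool"

definition er_noise_pmf :: "nat \<Rightarrow> real \<Rightarrow> real \<Rightarrow> sample pmf" where
  "er_noise_pmf n p eps =
     Pi_pmf (vpairs n) (False, False) (\<lambda>_. pair_pmf (bernoulli_pmf p) (bernoulli_pmf eps))"

(* W(i,j) = (-1)^{Y_ij} if edge present, 0 otherwise; Y_ij = x_i xor x_j xor Z_ij *)
definition Wmat :: "(nat \<Rightarrow> bool) \<Rightarrow> sample \<Rightarrow> nat \<Rightarrow> nat \<Rightarrow> real" where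
  "Wmat x \<omega> i j =
     (if i = j then 0 else
      (let e = \<omega> (min i j, max i j) in
       if fst e then (if (x i \<noteq> x j) \<noteq> snd e then -1 else 1) else 0))"

definition gvec :: "(nat \<Rightarrow> bool) \<Rightarrow> nat \<Rightarrow> real" where
  "gvec x i = (if x i then -1 else 1)"

(* n x n real matrices are functions nat => nat => real, only entries i,j < n matter *)
definition mat_trace_prod :: "nat \<Rightarrow> (nat \<Rightarrow> nat \<Rightarrow> real) \<Rightarrow> (nat \<Rightarrow> nat \<Rightarrow> real) \<Rightarrow> real" where
  "mat_trace_prod n A B = (\<Sum>i<n. \<Sum>j<n. A i j * B j i)"

definition psd :: "nat \<Rightarrow> (nat \<Rightarrow> nat \<Rightarrow> real) \<Rightarrow> bool" where
  "psd n X \<longleftrightarrow> (\<forall>i<n. \<forall>j<n. X i j = X j i) \<and>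
     (\<forall>v :: nat \<Rightarrow> real. (\<Sum>i<n. \<Sum>j<n. v i * X i j * v j) \<ge> 0)"

definition sdp_feasible :: "nat \<Rightarrow> (nat \<Rightarrow> nat \<Rightarrow> real) \<Rightarrow> bool" where
  "sdp_feasible n X \<longleftrightarrow> psd n X \<and> (\<forall>i<n. X i i = 1)"

definition mat_eq :: "nat \<Rightarrow> (nat \<Rightarrow> nat \<Rightarrow> real) \<Rightarrow> (nat \<Rightarrow> nat \<Rightarrow> real) \<Rightarrow> bool" where
  "mat_eq n A B \<longleftrightarrow> (\<forall>i<n. \<forall>j<n. A i j = B i j)"

definition sdp_unique_opt :: "nat \<Rightarrow> (nat \<Rightarrow> nat \<Rightarrow> real) \<Rightarrow> (nat \<Rightarrow> nat \<Rightarrow> real) \<Rightarrow> bool" where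
  "sdp_unique_opt n W X0 \<longleftrightarrow> sdp_feasible n X0 \<and>
     (\<forall>X. sdp_feasible n X \<and> \<not> mat_eq n X X0 \<longrightarrow> mat_trace_prod n W X < mat_trace_prod n W X0)"

end

theory Submission
  imports Defs
begin

text \<open>
  After conjugation with $g$, the matrix $gg^T$ is the unique optimum as soon as the signed Laplacian
  $L = \sum_{i<j} a_{ij} (e_i - e_j)(e_i - e_j)^T$, with $a_{ij} = \pm 1$ on correct and flipped edges
  and $0$ off the graph, is positive on the nonzero vectors orthogonal to the all-ones vector.
  The matrix Bernstein inequality is not needed to bound the failure probability: all summands have
  rank one, and for $b = e_i - e_j$ the function $\phi(s) = \mathrm{tr}\,(A + s\,bb^T)^N$ satisfies
  $\phi' = N h$ with $0 \le h' \le \kappa h$, since the moments $b^T A^l b$ are log-convex in $l$.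
  Hence $E\,\phi(\xi) \le \phi(0) + N h(0)\,E(e^{\kappa\xi} - 1)/\kappa \le \phi(c)$ for
  $c = E(e^{\kappa\xi} - 1)/\kappa$, so the edges can be replaced one at a time by the
  constant $c$. Starting from $I + cJ - \tau L$, this ends at the scalar matrix $(1 + nc) I$, whose
  $N$-th power has trace at most $n e^{N n c}$. On the failure event $I + cJ - \tau L$ has an
  eigenvalue at least $1$, and so has its power; Markov's inequality gives the bound.
\<close>

section \<open>Moments of positive definite matrices\<close>

definition vdot :: "nat \<Rightarrow> (nat \<Rightarrow> real) \<Rightarrow> (nat \<Rightarrow> real) \<Rightarrow> real" where
  "vdot n u v = (\<Sum>i<n. u i * v i)"

text \<open>A matrix is only meaningful on indices below \<open>n\<close>; for \<open>i \<ge> n\<close> the entry \<open>matvec n A v i\<close> is junk.\<close>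

definition matvec :: "nat \<Rightarrow> (nat \<Rightarrow> nat \<Rightarrow> real) \<Rightarrow> (nat \<Rightarrow> real) \<Rightarrow> nat \<Rightarrow> real" where
  "matvec n A v = (\<lambda>i. \<Sum>j<n. A i j * v j)"

text \<open>Powers occur only through their action on vectors, so iterating \<open>matvec\<close>
  replaces products of matrices.\<close>

definition matpow_vec :: "nat \<Rightarrow> (nat \<Rightarrow> nat \<Rightarrow> real) \<Rightarrow> nat \<Rightarrow> (nat \<Rightarrow> real) \<Rightarrow> nat \<Rightarrow> real" where
  "matpow_vec n A k v = (matvec n A ^^ k) v"

definition unit_vec :: "nat \<Rightarrow> nat \<Rightarrow> real" where
  "unit_vec j = (\<lambda>i. if i = j then 1 else 0)"

definition trace_pow :: "nat \<Rightarrow> (nat \<Rightarrow> nat \<Rightarrow> real) \<Rightarrow> nat \<Rightarrow> real" where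
  "trace_pow n A k = (\<Sum>j<n. matpow_vec n A k (unit_vec j) j)"

definition rank_one_update ::
  "(nat \<Rightarrow> nat \<Rightarrow> real) \<Rightarrow> (nat \<Rightarrow> real) \<Rightarrow> real \<Rightarrow> nat \<Rightarrow> nat \<Rightarrow> real" where
  "rank_one_update A b s = (\<lambda>i j. A i j + s * b i * b j)"

definition symm :: "nat \<Rightarrow> (nat \<Rightarrow> nat \<Rightarrow> real) \<Rightarrow> bool" where
  "symm n A \<longleftrightarrow> (\<forall>i<n. \<forall>j<n. A i j = A j i)"

text \<open>For symmetric A this says that every eigenvalue is at least m; the quadratic form states
  it without spectral theory.\<close>

definition coercive :: "nat \<Rightarrow> real \<Rightarrow> (nat \<Rightarrow> nat \<Rightarrow> real) \<Rightarrow> bool" where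
  "coercive n m A \<longleftrightarrow> symm n A \<and> (\<forall>v. m * vdot n v v \<le> vdot n v (matvec n A v))"

lemma matpow_vec_0 [simp]: "matpow_vec n A 0 v = v"
  and matpow_vec_Suc: "matpow_vec n A (Suc k) v = matvec n A (matpow_vec n A k v)"
  and matpow_vec_add: "matpow_vec n A (j + k) v = matpow_vec n A j (matpow_vec n A k v)"
  by (simp_all add: matpow_vec_def funpow_add)

lemma vdot_commute: "vdot n u v = vdot n v u"
  by (simp add: vdot_def mult.commute)

lemma vdot_self_nonneg: "0 \<le> vdot n v v"
  by (simp add: vdot_def sum_nonneg)

lemma vdot_self_pos: "i < n \<Longrightarrow> v i \<noteq> 0 \<Longrightarrow> 0 < vdot n v v"
  unfolding vdot_def by (rule sum_pos2[of _ i]) (auto simp: zero_less_mult_iff)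

lemma vdot_unit_vec:
  assumes "j < n"
  shows "vdot n v (unit_vec j) = v j"
  using assms by (simp add: vdot_def unit_vec_def if_distrib cong: if_cong)

lemma matvec_add_scale:
  "matvec n A (\<lambda>i. u i + t * v i) = (\<lambda>i. matvec n A u i + t * matvec n A v i)"
  by (simp add: matvec_def fun_eq_iff algebra_simps sum.distrib sum_distrib_left)

lemma vdot_add_scale_left: "vdot n (\<lambda>i. u i + t * v i) w = vdot n u w + t * vdot n v w"
  by (simp add: vdot_def algebra_simps sum.distrib sum_distrib_left)

lemma vdot_add_scale_right: "vdot n w (\<lambda>i. u i + t * v i) = vdot n w u + t * vdot n w v"
  by (simp add: vdot_def algebra_simps sum.distrib sum_distrib_left)

lemma vdot_matvec:
  assumes "symm n A"
  shows "vdot n (matvec n A u) v = vdot n u (matvec n A v)"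
proof -
  have "vdot n (matvec n A u) v = (\<Sum>i<n. \<Sum>j<n. A i j * u j * v i)"
    by (simp add: vdot_def matvec_def sum_distrib_right)
  also have "\<dots> = (\<Sum>j<n. \<Sum>i<n. A i j * u j * v i)"
    by (rule sum.swap)
  also have "\<dots> = vdot n u (matvec n A v)"
    using assms by (auto simp: vdot_def matvec_def sum_distrib_left symm_def intro!: sum.cong)
  finally show ?thesis .
qed

lemma vdot_matpow_vec:
  assumes "symm n A"
  shows "vdot n (matpow_vec n A k u) v = vdot n u (matpow_vec n A k v)"
proof (induction k arbitrary: u v)
  case (Suc k)
  have "vdot n (matpow_vec n A (Suc k) u) v = vdot n u (matpow_vec n A k (matvec n A v))"
    using Suc by (simp add: matpow_vec_Suc vdot_matvec[OF assms])
  also have "matpow_vec n A k (matvec n A v) = matpow_vec n A (Suc k) v"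
    using matpow_vec_add[of n A k 1 v] by (simp add: matpow_vec_Suc)
  finally show ?case .
qed simp

lemma vdot_matpow_vec_add:
  assumes "symm n A"
  shows "vdot n (matpow_vec n A j u) (matpow_vec n A k v) = vdot n u (matpow_vec n A (j + k) v)"
  by (simp add: vdot_matpow_vec[OF assms] matpow_vec_add)

lemma vdot_Cauchy_Schwarz: "(vdot n u v)\<^sup>2 \<le> vdot n u u * vdot n v v"
  using Cauchy_Schwarz_ineq_sum[of u v "{..<n}"] by (simp add: vdot_def power2_eq_square)

text \<open>The form of A at u + t v is a quadratic polynomial in t without negative values, so its
  discriminant is at most 0.\<close>

lemma coercive_Cauchy_Schwarz:
  assumes A: "coercive n m A" and "0 < m"
  shows "(vdot n u (matvec n A v))\<^sup>2 \<le> vdot n u (matvec n A u) * vdot n v (matvec n A v)"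
proof -
  have sA: "symm n A" using A by (simp add: coercive_def)
  define \<alpha> \<beta> \<gamma> where "\<alpha> = vdot n u (matvec n A u)" and "\<beta> = vdot n u (matvec n A v)"
    and "\<gamma> = vdot n v (matvec n A v)"
  have nn: "0 \<le> vdot n w (matvec n A w)" for w
    using A \<open>0 < m\<close> vdot_self_nonneg[of n w] unfolding coercive_def
    by (meson mult_nonneg_nonneg less_imp_le order_trans)
  have "vdot n v (matvec n A u) = \<beta>"
    unfolding \<beta>_def by (metis vdot_matvec[OF sA] vdot_commute)
  then have q: "0 \<le> \<alpha> + 2 * t * \<beta> + t\<^sup>2 * \<gamma>" for t
    using nn[of "\<lambda>i. u i + t * v i"] unfolding matvec_add_scale
    by (simp add: \<alpha>_def \<beta>_def \<gamma>_def vdot_add_scale_left vdot_add_scale_right algebra_simps power2_eq_square)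
  have "\<beta>\<^sup>2 \<le> \<alpha> * \<gamma>"
  proof (cases "\<gamma> = 0")
    case True
    have "\<beta> = 0"
    proof (rule ccontr)
      assume "\<beta> \<noteq> 0"
      \<comment> \<open>At this t the polynomial, linear when \<gamma> = 0, takes the value
        -1.\<close>
      then show False using q[of "- (\<alpha> + 1) / (2 * \<beta>)"] True by (simp add: field_simps)
    qed
    then show ?thesis using True by simp
  next
    case False
    then have "0 < \<gamma>" using nn[of v] by (simp add: \<gamma>_def)
    \<comment> \<open>The minimiser of the quadratic polynomial.\<close>
    then show ?thesis using q[of "- \<beta> / \<gamma>"]
      by (simp add: field_simps power2_eq_square)
  qed
  then show ?thesis by (simp add: \<alpha>_def \<beta>_def \<gamma>_def)
qed

text \<open>Distributing the powers over both arguments gives a Cauchy-Schwarz inequality for w =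
  A^i b and A w: for the standard inner product if k = 2i, and for the one induced by A if k = 2i +
  1.\<close>

lemma moment_log_convex:
  assumes A: "coercive n m A" and "0 < m"
  shows "(vdot n b (matpow_vec n A (Suc k) b))\<^sup>2
    \<le> vdot n b (matpow_vec n A k b) * vdot n b (matpow_vec n A (Suc (Suc k)) b)"
proof -
  have sA: "symm n A" using A by (simp add: coercive_def)
  show ?thesis
  proof (cases "even k")
    case True
    then obtain i where k: "k = i + i" by (metis evenE mult_2)
    have "vdot n b (matpow_vec n A (Suc k) b) = vdot n (matpow_vec n A i b) (matpow_vec n A (Suc i) b)"
      "vdot n b (matpow_vec n A k b) = vdot n (matpow_vec n A i b) (matpow_vec n A i b)"
      "vdot n b (matpow_vec n A (Suc (Suc k)) b)
        = vdot n (matpow_vec n A (Suc i) b) (matpow_vec n A (Suc i) b)"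
      by (simp_all add: k vdot_matpow_vec_add[OF sA])
    then show ?thesis using vdot_Cauchy_Schwarz by simp
  next
    case False
    then obtain i where k: "k = Suc (i + i)" by (metis oddE mult_2 Suc_eq_plus1)
    let ?w = "matpow_vec n A i b"
    have "vdot n b (matpow_vec n A (Suc k) b) = vdot n ?w (matvec n A (matvec n A ?w))"
      "vdot n b (matpow_vec n A k b) = vdot n ?w (matvec n A ?w)"
      "vdot n b (matpow_vec n A (Suc (Suc k)) b)
        = vdot n (matvec n A ?w) (matvec n A (matvec n A ?w))"
      by (simp_all add: k matpow_vec_Suc[symmetric] vdot_matpow_vec_add[OF sA])
    then show ?thesis
      using coercive_Cauchy_Schwarz[OF assms, of ?w "matvec n A ?w"] by simp
  qed
qed

text \<open>Log-convexity bounds a moment below through its two predecessors, so the induction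
  carries two consecutive moments.\<close>

lemma moment_pos:
  assumes A: "coercive n m A" and "0 < m" and "0 < vdot n b b"
  shows "0 < vdot n b (matpow_vec n A k b)"
proof -
  let ?a = "\<lambda>k. vdot n b (matpow_vec n A k b)"
  have "0 < ?a k \<and> 0 < ?a (Suc k)"
  proof (induction k)
    case 0
    have "m * vdot n b b \<le> ?a (Suc 0)" using A by (simp add: coercive_def matpow_vec_Suc)
    moreover have "0 < m * vdot n b b" using assms(2,3) by simp
    ultimately show ?case using assms(3) by simp
  next
    case (Suc k)
    then have "0 < (?a (Suc k))\<^sup>2" by simp
    also have "\<dots> \<le> ?a k * ?a (Suc (Suc k))" by (rule moment_log_convex[OF A \<open>0 < m\<close>])
    finally show ?case using Suc by (simp add: zero_less_mult_iff)
  qed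
  then show ?thesis ..
qed

text \<open>For positive sequences log-convexity means exactly that the ratios of successive terms
  do not decrease.\<close>

lemma moment_ratio_mono:
  assumes A: "coercive n m A" and "0 < m" and "0 < vdot n b b"
  shows "vdot n b (matpow_vec n A (Suc k) b) / vdot n b (matpow_vec n A k b)
    \<le> vdot n b (matpow_vec n A (Suc (k + l)) b) / vdot n b (matpow_vec n A (k + l) b)"
proof (induction l)
  case (Suc l)
  note pos = moment_pos[OF assms]
  have "vdot n b (matpow_vec n A (Suc (k + l)) b) / vdot n b (matpow_vec n A (k + l) b)
    \<le> vdot n b (matpow_vec n A (Suc (Suc (k + l))) b) / vdot n b (matpow_vec n A (Suc (k + l)) b)"
    using moment_log_convex[OF A \<open>0 < m\<close>, of b "k + l"] pos[of "k+l"] pos[of "Suc (k+l)"]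
    by (simp add: field_simps power2_eq_square)
  with Suc show ?case by simp
qed simp

text \<open>Passing from j to j + 1 multiplies the left side by the ratio at j and the right side by
  the ratio at j + k, which is no smaller.\<close>

lemma moment_mult_le:
  assumes A: "coercive n m A" and "0 < m" and "0 < vdot n b b"
  shows "vdot n b (matpow_vec n A j b) * vdot n b (matpow_vec n A k b)
    \<le> vdot n b b * vdot n b (matpow_vec n A (j + k) b)"
proof (induction j)
  case (Suc j)
  let ?a = "\<lambda>k. vdot n b (matpow_vec n A k b)"
  note pos = moment_pos[OF assms]
  have "?a (Suc j) * ?a k = (?a (Suc j) / ?a j) * (?a j * ?a k)"
    using pos[of j] by simp
  also have "\<dots> \<le> (?a (Suc j) / ?a j) * (vdot n b b * ?a (j + k))"
    using Suc pos[of j] pos[of "Suc j"] by (intro mult_left_mono) auto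
  also have "\<dots> \<le> (?a (Suc (j + k)) / ?a (j + k)) * (vdot n b b * ?a (j + k))"
    using moment_ratio_mono[OF assms, of j k] pos[of "j + k"] assms(3)
    by (intro mult_right_mono) auto
  also have "\<dots> = vdot n b b * ?a (Suc j + k)"
    using pos[of "j + k"] by simp
  finally show ?case .
qed simp

text \<open>The hypothesis bounds the first ratio, and all later ratios are at least as
  large.\<close>

lemma moment_growth:
  assumes A: "coercive n m A" and "0 < m" and "0 < vdot n b b"
    and c: "c * vdot n b b \<le> vdot n b (matvec n A b)"
  shows "c * vdot n b (matpow_vec n A k b) \<le> vdot n b (matpow_vec n A (Suc k) b)"
proof -
  note pos = moment_pos[OF assms(1-3)]
  have "c \<le> vdot n b (matpow_vec n A (Suc 0) b) / vdot n b (matpow_vec n A 0 b)"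
    using c assms(3) by (simp add: matpow_vec_Suc field_simps)
  also have "\<dots> \<le> vdot n b (matpow_vec n A (Suc k) b) / vdot n b (matpow_vec n A k b)"
    using moment_ratio_mono[OF assms(1-3), of 0 k] by simp
  finally show ?thesis using pos[of k] by (simp add: field_simps)
qed

text \<open>The sum is the derivative at s = 0 of the k-th moment of A + s b b^T, so this is the
  inequality h' \<le> \<kappa> h. Each of the k products is at most the zeroth moment times the
  (k-1)-st, and going up to the k-th gains a factor m.\<close>

lemma moment_convolution_le:
  assumes A: "coercive n m A" and "0 < m" and "0 < vdot n b b"
  shows "(\<Sum>l<k. vdot n b (matpow_vec n A l b) * vdot n b (matpow_vec n A (k - 1 - l) b))
    \<le> real k * vdot n b b / m * vdot n b (matpow_vec n A k b)"
proof (cases k)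
  case (Suc k')
  have "(\<Sum>l<k. vdot n b (matpow_vec n A l b) * vdot n b (matpow_vec n A (k - 1 - l) b))
    \<le> (\<Sum>l<k. vdot n b b * vdot n b (matpow_vec n A k' b))"
    using moment_mult_le[OF assms] by (intro sum_mono) (metis Suc diff_Suc_1 le_add_diff_inverse lessThan_iff less_Suc_eq_le)
  also have "\<dots> = real k * vdot n b b * vdot n b (matpow_vec n A k' b)" by simp
  also have "\<dots> \<le> real k * vdot n b b * (vdot n b (matpow_vec n A k b) / m)"
  proof (rule mult_left_mono)
    have "m * vdot n b (matpow_vec n A k' b) \<le> vdot n b (matpow_vec n A k b)"
      unfolding Suc by (rule moment_growth[OF assms]) (use A in \<open>simp add: coercive_def\<close>)
    then show "vdot n b (matpow_vec n A k' b) \<le> vdot n b (matpow_vec n A k b) / m"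
      using \<open>0 < m\<close> by (simp add: field_simps)
  qed (use assms(3) in simp)
  finally show ?thesis by (simp add: field_simps)
qed simp

section \<open>Traces of even powers as squared Frobenius norms\<close>

lemma trace_pow_even:
  assumes "symm n A"
  shows "trace_pow n A (k + k) = (\<Sum>j<n. vdot n (matpow_vec n A k (unit_vec j)) (matpow_vec n A k (unit_vec j)))"
  unfolding trace_pow_def
proof (rule sum.cong)
  fix j assume "j \<in> {..<n}"
  then have "matpow_vec n A (k + k) (unit_vec j) j = vdot n (unit_vec j) (matpow_vec n A (k + k) (unit_vec j))"
    by (simp add: vdot_unit_vec vdot_commute[of n "unit_vec j"])
  then show "matpow_vec n A (k + k) (unit_vec j) j
    = vdot n (matpow_vec n A k (unit_vec j)) (matpow_vec n A k (unit_vec j))"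
    by (simp add: vdot_matpow_vec_add[OF assms])
qed simp

lemma trace_pow_even_nonneg:
  assumes "symm n A"
  shows "0 \<le> trace_pow n A (k + k)"
  unfolding trace_pow_even[OF assms] by (intro sum_nonneg vdot_self_nonneg)

text \<open>The left side is the squared length of A^k v, and the Frobenius norm of A^k dominates
  its operator norm. This replaces the bound of the trace by the largest eigenvalue.\<close>

lemma moment_le_trace_pow:
  assumes "symm n A"
  shows "vdot n v (matpow_vec n A (k + k) v) \<le> vdot n v v * trace_pow n A (k + k)"
proof -
  let ?w = "matpow_vec n A k v"
  have "vdot n v (matpow_vec n A (k + k) v) = vdot n ?w ?w"
    by (simp add: vdot_matpow_vec_add[OF assms])
  also have "\<dots> = (\<Sum>j<n. (vdot n v (matpow_vec n A k (unit_vec j)))\<^sup>2)"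
    unfolding vdot_def[of n ?w]
  proof (rule sum.cong)
    fix j assume "j \<in> {..<n}"
    then have "?w j = vdot n ?w (unit_vec j)" by (simp add: vdot_unit_vec)
    then show "?w j * ?w j = (vdot n v (matpow_vec n A k (unit_vec j)))\<^sup>2"
      by (simp add: vdot_matpow_vec[OF assms] power2_eq_square)
  qed simp
  also have "\<dots> \<le> (\<Sum>j<n. vdot n v v * vdot n (matpow_vec n A k (unit_vec j)) (matpow_vec n A k (unit_vec j)))"
    by (intro sum_mono vdot_Cauchy_Schwarz)
  also have "\<dots> = vdot n v v * trace_pow n A (k + k)"
    by (simp add: trace_pow_even[OF assms] sum_distrib_left)
  finally show ?thesis .
qed

text \<open>A Rayleigh quotient of at least 1 persists under powers because the moments of v never
  decrease.\<close>

lemma trace_pow_ge_1: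
  assumes A: "coercive n m A" "0 < m" and v: "0 < vdot n v v"
    and "vdot n v v \<le> vdot n v (matvec n A v)"
  shows "1 \<le> trace_pow n A (k + k)"
proof -
  have "vdot n v v \<le> vdot n v (matpow_vec n A j v)" for j
    using moment_growth[OF A v, of 1] assms(4) by (induction j) (auto intro: order_trans)
  from this[of "k + k"] have "vdot n v v \<le> vdot n v v * trace_pow n A (k + k)"
    using moment_le_trace_pow[of n A v k] A by (simp add: coercive_def)
  then show ?thesis using v by simp
qed

section \<open>Traces of powers under rank-one updates\<close>

lemma matvec_rank_one_update:
  "matvec n (rank_one_update A b s) v i = matvec n A v i + s * vdot n b v * b i"
  by (simp add: matvec_def rank_one_update_def vdot_def algebra_simps sum.distrib sum_distrib_left)

lemma matvec_sum:
  "matvec n A (\<lambda>i. \<Sum>l\<in>S. c l * w l i) j = (\<Sum>l\<in>S. c l * matvec n A (w l) j)"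
proof -
  have "matvec n A (\<lambda>i. \<Sum>l\<in>S. c l * w l i) j = (\<Sum>i<n. \<Sum>l\<in>S. c l * (A j i * w l i))"
    by (simp add: matvec_def sum_distrib_left mult_ac)
  also have "\<dots> = (\<Sum>l\<in>S. \<Sum>i<n. c l * (A j i * w l i))"
    by (rule sum.swap)
  finally show ?thesis by (simp add: matvec_def sum_distrib_left)
qed

lemma matvec_deriv:
  assumes "\<And>i. ((\<lambda>s. w s i) has_real_derivative w' i) (at s)"
  shows "((\<lambda>s. matvec n A (w s) i) has_real_derivative matvec n A w' i) (at s)"
  unfolding matvec_def by (intro DERIV_sum DERIV_cmult assms)

lemma vdot_deriv:
  assumes "\<And>i. ((\<lambda>s. w s i) has_real_derivative w' i) (at s)"
  shows "((\<lambda>s. vdot n b (w s)) has_real_derivative vdot n b w') (at s)"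
  unfolding vdot_def by (intro DERIV_sum DERIV_cmult assms)

text \<open>Product rule for B^k: differentiating one factor B leaves b b^T in its place, with B^l
  to the left and B^(k-1-l) to the right.\<close>

lemma matpow_vec_rank_one_deriv:
  fixes A b
  defines "B \<equiv> rank_one_update A b"
  shows "((\<lambda>s. matpow_vec n (B s) k v i) has_real_derivative
    (\<Sum>l<k. vdot n b (matpow_vec n (B s) (k - 1 - l) v) * matpow_vec n (B s) l b i)) (at s)"
proof (induction k arbitrary: i)
  case (Suc k)
  let ?w = "\<lambda>s. matpow_vec n (B s) k v"
  let ?D = "\<lambda>i. \<Sum>l<k. vdot n b (matpow_vec n (B s) (k - 1 - l) v) * matpow_vec n (B s) l b i"
  have "((\<lambda>s. matvec n A (?w s) i + s * vdot n b (?w s) * b i) has_real_derivative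
      (matvec n A ?D i + (vdot n b (?w s) + s * vdot n b ?D) * b i)) (at s)"
    by (rule derivative_eq_intros matvec_deriv vdot_deriv Suc.IH refl)+ (simp add: algebra_simps)
  also have "matvec n A ?D i + (vdot n b (?w s) + s * vdot n b ?D) * b i
     = vdot n b (?w s) * b i + matvec n (B s) ?D i"
    by (simp add: B_def matvec_rank_one_update algebra_simps)
  also have "matvec n (B s) ?D i
    = (\<Sum>l<k. vdot n b (matpow_vec n (B s) (k - 1 - l) v) * matpow_vec n (B s) (Suc l) b i)"
    by (simp add: matvec_sum matpow_vec_Suc)
  \<comment> \<open>Differentiating the outermost factor gives the summand l = 0; the inner ones
    move up from l to l + 1.\<close>
  also have "vdot n b (?w s) * b i
       + (\<Sum>l<k. vdot n b (matpow_vec n (B s) (k - 1 - l) v) * matpow_vec n (B s) (Suc l) b i)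
     = (\<Sum>l<Suc k. vdot n b (matpow_vec n (B s) (Suc k - 1 - l) v) * matpow_vec n (B s) l b i)"
    by (subst sum.lessThan_Suc_shift) simp
  also have "(\<lambda>s. matvec n A (?w s) i + s * vdot n b (?w s) * b i) = (\<lambda>s. matpow_vec n (B s) (Suc k) v i)"
    by (simp add: matpow_vec_Suc B_def matvec_rank_one_update)
  finally show ?case .
qed simp

lemma symm_rank_one_update: "symm n A \<Longrightarrow> symm n (rank_one_update A b s)"
  by (simp add: symm_def rank_one_update_def)

text \<open>Under the trace the k summands of the product rule coincide: by symmetry the powers on
  both sides of b b^T combine to B^(k-1).\<close>

lemma trace_pow_rank_one_deriv:
  assumes "symm n A"
  shows "((\<lambda>s. trace_pow n (rank_one_update A b s) k) has_real_derivative
    real k * vdot n b (matpow_vec n (rank_one_update A b s) (k - 1) b)) (at s)"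
proof -
  let ?B = "rank_one_update A b s"
  have sB: "symm n ?B" by (rule symm_rank_one_update[OF assms])
  have eq: "vdot n b (matpow_vec n ?B j (unit_vec i)) = matpow_vec n ?B j b i" if "i < n" for i j
    using that by (simp add: vdot_matpow_vec[OF sB, symmetric] vdot_unit_vec)
  have "(\<Sum>i<n. \<Sum>l<k. vdot n b (matpow_vec n ?B (k - 1 - l) (unit_vec i)) * matpow_vec n ?B l b i)
    = (\<Sum>i<n. \<Sum>l<k. matpow_vec n ?B (k - 1 - l) b i * matpow_vec n ?B l b i)"
    by (simp add: eq)
  also have "\<dots> = (\<Sum>l<k. vdot n (matpow_vec n ?B (k - 1 - l) b) (matpow_vec n ?B l b))"
    unfolding vdot_def by (rule sum.swap)
  also have "\<dots> = (\<Sum>l<k. vdot n b (matpow_vec n ?B (k - 1) b))"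
    by (intro sum.cong) (auto simp: vdot_matpow_vec_add[OF sB])
  finally show ?thesis unfolding trace_pow_def
    by (auto intro!: derivative_eq_intros matpow_vec_rank_one_deriv)
qed

lemma moment_rank_one_deriv:
  "((\<lambda>s. vdot n b (matpow_vec n (rank_one_update A b s) k b)) has_real_derivative
    (\<Sum>l<k. vdot n b (matpow_vec n (rank_one_update A b s) l b)
          * vdot n b (matpow_vec n (rank_one_update A b s) (k - 1 - l) b))) (at s)"
proof -
  let ?B = "rank_one_update A b s"
  have "vdot n b (\<lambda>i. \<Sum>l<k. vdot n b (matpow_vec n ?B (k - 1 - l) b) * matpow_vec n ?B l b i)
    = (\<Sum>i<n. \<Sum>l<k. b i * matpow_vec n ?B l b i * vdot n b (matpow_vec n ?B (k - 1 - l) b))"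
    by (subst vdot_def) (simp add: sum_distrib_left mult_ac)
  also have "\<dots> = (\<Sum>l<k. \<Sum>i<n. b i * matpow_vec n ?B l b i * vdot n b (matpow_vec n ?B (k - 1 - l) b))"
    by (rule sum.swap)
  also have "\<dots> = (\<Sum>l<k. vdot n b (matpow_vec n ?B l b) * vdot n b (matpow_vec n ?B (k - 1 - l) b))"
    unfolding vdot_def[of n b "matpow_vec n ?B _ b"] sum_distrib_right[symmetric] by simp
  finally show ?thesis 
    using vdot_deriv[of "\<lambda>s. matpow_vec n (rank_one_update A b s) k b", OF matpow_vec_rank_one_deriv, of n b s]
    by simp
qed

text \<open>Since h(t) exp(-\<kappa> t) does not increase, h lies below h(0) exp(\<kappa> t) to the
  right of 0 and above it to the left; integrating from 0 gives the upper bound in both directions.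
  The lower bound is the tangent at 0 of the convex function \<phi>.\<close>

lemma log_Lipschitz_convex_bounds:
  fixes \<phi> h h' :: "real \<Rightarrow> real"
  assumes N: "0 \<le> N" and \<kappa>: "0 < \<kappa>"
    and d\<phi>: "\<And>t. (\<phi> has_real_derivative N * h t) (at t)"
    and dh: "\<And>t. (h has_real_derivative h' t) (at t)"
    and bounds: "\<And>t. \<bar>t\<bar> \<le> \<eta> \<Longrightarrow> 0 \<le> h' t \<and> h' t \<le> \<kappa> * h t"
    and s: "\<bar>s\<bar> \<le> \<eta>"
  shows "\<phi> s \<le> \<phi> 0 + N * h 0 * ((exp (\<kappa> * s) - 1) / \<kappa>)"
    and "\<phi> 0 + N * h 0 * s \<le> \<phi> s"
proof -
  let ?u = "\<lambda>t. h t * exp (- \<kappa> * t)"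
  have du: "(?u has_real_derivative (h' t - \<kappa> * h t) * exp (- \<kappa> * t)) (at t)" for t
    by (auto intro!: derivative_eq_intros dh simp: algebra_simps)
  have anti: "?u b \<le> ?u a" if "a \<le> b" "- \<eta> \<le> a" "b \<le> \<eta>" for a b
  proof (rule DERIV_nonpos_imp_nonincreasing[OF that(1)], intro exI conjI)
    fix t assume "a \<le> t" "t \<le> b"
    then have "h' t \<le> \<kappa> * h t" using that bounds[of t] by auto
    then show "(h' t - \<kappa> * h t) * exp (- \<kappa> * t) \<le> 0" by (simp add: mult_nonpos_nonneg)
  qed (rule du)
  have mono: "h a \<le> h b" if "a \<le> b" "- \<eta> \<le> a" "b \<le> \<eta>" for a b
  proof (rule DERIV_nonneg_imp_nondecreasing[OF that(1)], intro exI conjI)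
    fix t assume "a \<le> t" "t \<le> b"
    then show "0 \<le> h' t" using that bounds[of t] by auto
  qed (rule dh)
  have up: "h t \<le> h 0 * exp (\<kappa> * t)" if "0 \<le> t" "t \<le> \<eta>" for t
    using anti[of 0 t] that by (simp add: exp_minus field_simps)
  have lo: "h 0 * exp (\<kappa> * t) \<le> h t" if "t \<le> 0" "- \<eta> \<le> t" for t
    using anti[of t 0] that by (simp add: exp_minus field_simps)
  let ?\<psi> = "\<lambda>t. \<phi> t - N * h 0 * ((exp (\<kappa> * t) - 1) / \<kappa>)"
  have d\<psi>: "(?\<psi> has_real_derivative N * (h t - h 0 * exp (\<kappa> * t))) (at t)" for t
    using \<kappa> by (auto intro!: derivative_eq_intros d\<phi> simp: algebra_simps)
  let ?\<chi> = "\<lambda>t. \<phi> t - N * h 0 * t"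
  have d\<chi>: "(?\<chi> has_real_derivative N * (h t - h 0)) (at t)" for t
    by (auto intro!: derivative_eq_intros d\<phi> simp: algebra_simps)
  \<comment> \<open>On the interval, 0 is a maximum of \<open>?\<psi>\<close> and a minimum of
    \<open>?\<chi>\<close>; both derivatives change sign there, whence the two cases.\<close>
  have "?\<psi> s \<le> ?\<psi> 0 \<and> ?\<chi> 0 \<le> ?\<chi> s"
  proof (cases "0 \<le> s")
    case True
    have "?\<psi> s \<le> ?\<psi> 0"
    proof (rule DERIV_nonpos_imp_nonincreasing[OF True], intro exI conjI)
      fix t assume "0 \<le> t" "t \<le> s"
      then show "N * (h t - h 0 * exp (\<kappa> * t)) \<le> 0"
        using s up[of t] N by (simp add: mult_nonneg_nonpos)
    qed (rule d\<psi>)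
    moreover have "?\<chi> 0 \<le> ?\<chi> s"
    proof (rule DERIV_nonneg_imp_nondecreasing[OF True], intro exI conjI)
      fix t assume "0 \<le> t" "t \<le> s"
      then show "0 \<le> N * (h t - h 0)" using s mono[of 0 t] N by simp
    qed (rule d\<chi>)
    ultimately show ?thesis ..
  next
    case False
    then have s0: "s \<le> 0" by simp
    have "?\<psi> s \<le> ?\<psi> 0"
    proof (rule DERIV_nonneg_imp_nondecreasing[OF s0], intro exI conjI)
      fix t assume "s \<le> t" "t \<le> 0"
      then show "0 \<le> N * (h t - h 0 * exp (\<kappa> * t))" using s lo[of t] N by simp
    qed (rule d\<psi>)
    moreover have "?\<chi> 0 \<le> ?\<chi> s"
    proof (rule DERIV_nonpos_imp_nonincreasing[OF s0], intro exI conjI)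
      fix t assume "s \<le> t" "t \<le> 0"
      then show "N * (h t - h 0) \<le> 0" using s mono[of t 0] N by (simp add: mult_nonneg_nonpos)
    qed (rule d\<chi>)
    ultimately show ?thesis ..
  qed
  then show "\<phi> s \<le> \<phi> 0 + N * h 0 * ((exp (\<kappa> * s) - 1) / \<kappa>)" "\<phi> 0 + N * h 0 * s \<le> \<phi> s"
    by simp_all
qed

text \<open>The exponent is \<open>Suc k\<close> because the derivative of that trace is a multiple
  of the k-th moment, whose logarithmic derivative is at most \<kappa>.\<close>

lemma trace_pow_rank_one_bounds:
  assumes sA: "symm n A" and m: "0 < m" and b: "0 < vdot n b b" and k: "0 < k"
    and co: "\<And>t. \<bar>t\<bar> \<le> \<eta> \<Longrightarrow> coercive n m (rank_one_update A b t)"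
    and s: "\<bar>s\<bar> \<le> \<eta>"
  defines "\<kappa> \<equiv> real k * vdot n b b / m"
    and "h \<equiv> real (Suc k) * vdot n b (matpow_vec n (rank_one_update A b 0) k b)"
    and "\<phi> \<equiv> \<lambda>t. trace_pow n (rank_one_update A b t) (Suc k)"
  shows "\<phi> s \<le> \<phi> 0 + h * ((exp (\<kappa> * s) - 1) / \<kappa>)" and "\<phi> 0 + h * s \<le> \<phi> s"
proof -
  let ?B = "rank_one_update A b"
  let ?h' = "\<lambda>t. \<Sum>l<k. vdot n b (matpow_vec n (?B t) l b) * vdot n b (matpow_vec n (?B t) (k - 1 - l) b)"
  have \<kappa>: "0 < \<kappa>" using b k m by (simp add: \<kappa>_def)
  have d\<phi>: "(\<phi> has_real_derivative real (Suc k) * vdot n b (matpow_vec n (?B t) k b)) (at t)" for t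
    unfolding \<phi>_def using trace_pow_rank_one_deriv[OF sA, of b "Suc k" t] by simp
  have bd: "0 \<le> ?h' t \<and> ?h' t \<le> \<kappa> * vdot n b (matpow_vec n (?B t) k b)" if "\<bar>t\<bar> \<le> \<eta>" for t
    using moment_convolution_le[OF co[OF that] m b, of k] moment_pos[OF co[OF that] m b]
    by (simp add: \<kappa>_def sum_nonneg less_imp_le)
  show "\<phi> s \<le> \<phi> 0 + h * ((exp (\<kappa> * s) - 1) / \<kappa>)" and "\<phi> 0 + h * s \<le> \<phi> s"
    using log_Lipschitz_convex_bounds[OF _ \<kappa> d\<phi> moment_rank_one_deriv bd s]
    by (simp_all add: h_def)
qed

section \<open>Signed Laplacians\<close>

text \<open>The quadratic form of the Laplacian with weights a; the division by 2 compensates for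
  counting each unordered pair twice.\<close>

definition lap_form :: "nat \<Rightarrow> (nat \<Rightarrow> nat \<Rightarrow> real) \<Rightarrow> (nat \<Rightarrow> real) \<Rightarrow> real" where
  "lap_form n a v = (\<Sum>i<n. \<Sum>j<n. a i j * (v i - v j)\<^sup>2) / 2"

text \<open>
  The matrix \<open>I + c J + L\<close> with \<open>L\<close> the Laplacian of the weights \<open>a\<close>; the summand \<open>c J\<close> makes it
  scalar when all off-diagonal weights equal \<open>c\<close>.
\<close>

definition shifted_laplacian :: "nat \<Rightarrow> real \<Rightarrow> (nat \<Rightarrow> nat \<Rightarrow> real) \<Rightarrow> nat \<Rightarrow> nat \<Rightarrow> real" where
  "shifted_laplacian n c a = (\<lambda>i j. (if i = j then 1 + (\<Sum>l<n. a i l) else 0) + c - a i j)"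

lemma lap_form_eq:
  assumes "symm n a"
  shows "lap_form n a v = (\<Sum>i<n. \<Sum>j<n. a i j * (v i)\<^sup>2) - (\<Sum>i<n. \<Sum>j<n. a i j * v i * v j)"
proof -
  have "(\<Sum>i<n. \<Sum>j<n. a i j * (v j)\<^sup>2) = (\<Sum>j<n. \<Sum>i<n. a i j * (v j)\<^sup>2)"
    by (rule sum.swap)
  also have "\<dots> = (\<Sum>i<n. \<Sum>j<n. a i j * (v i)\<^sup>2)"
    using assms by (auto simp: symm_def intro!: sum.cong)
  finally have sw: "(\<Sum>i<n. \<Sum>j<n. a i j * (v j)\<^sup>2) = (\<Sum>i<n. \<Sum>j<n. a i j * (v i)\<^sup>2)" .
  have "a i j * (v i - v j)\<^sup>2 = a i j * (v i)\<^sup>2 + a i j * (v j)\<^sup>2 - 2 * (a i j * v i * v j)" for i j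
    by (simp add: power2_eq_square algebra_simps)
  then have "2 * lap_form n a v = (\<Sum>i<n. \<Sum>j<n. a i j * (v i)\<^sup>2) + (\<Sum>i<n. \<Sum>j<n. a i j * (v j)\<^sup>2)
    - 2 * (\<Sum>i<n. \<Sum>j<n. a i j * v i * v j)"
    by (simp add: lap_form_def sum.distrib sum_subtractf sum_distrib_left[symmetric])
  then show ?thesis by (simp add: sw)
qed

lemma vdot_shifted_laplacian:
  assumes "symm n a"
  shows "vdot n v (matvec n (shifted_laplacian n c a) v)
    = vdot n v v + c * (\<Sum>i<n. v i)\<^sup>2 + lap_form n a v"
proof -
  have row: "matvec n (shifted_laplacian n c a) v i
      = v i + (\<Sum>j<n. a i j) * v i + c * (\<Sum>j<n. v j) - (\<Sum>j<n. a i j * v j)" if "i < n" for i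
  proof -
    have "matvec n (shifted_laplacian n c a) v i
      = (\<Sum>j<n. (if i = j then (1 + (\<Sum>l<n. a i l)) * v j else 0) + c * v j - a i j * v j)"
      unfolding matvec_def shifted_laplacian_def by (intro sum.cong) (auto simp: algebra_simps)
    then show ?thesis using that
      by (simp add: sum.distrib sum_subtractf sum_distrib_left algebra_simps)
  qed
  have "vdot n v (matvec n (shifted_laplacian n c a) v)
    = (\<Sum>i<n. v i * v i + (\<Sum>j<n. a i j * (v i)\<^sup>2) + v i * (c * (\<Sum>j<n. v j)) - (\<Sum>j<n. a i j * v i * v j))"
    unfolding vdot_def
  proof (rule sum.cong)
    fix i assume "i \<in> {..<n}"
    have "(\<Sum>j<n. a i j * (v i)\<^sup>2) = v i * ((\<Sum>j<n. a i j) * v i)"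
      "(\<Sum>j<n. a i j * v i * v j) = v i * (\<Sum>j<n. a i j * v j)"
      by (simp_all add: sum_distrib_left sum_distrib_right power2_eq_square mult_ac)
    then show "v i * matvec n (shifted_laplacian n c a) v i
      = v i * v i + (\<Sum>j<n. a i j * (v i)\<^sup>2) + v i * (c * (\<Sum>j<n. v j)) - (\<Sum>j<n. a i j * v i * v j)"
      using \<open>i \<in> {..<n}\<close> by (simp only: row lessThan_iff) (simp add: algebra_simps)
  qed simp
  also have "\<dots> = vdot n v v + (\<Sum>i<n. \<Sum>j<n. a i j * (v i)\<^sup>2) + (\<Sum>i<n. v i) * (c * (\<Sum>j<n. v j))
      - (\<Sum>i<n. \<Sum>j<n. a i j * v i * v j)"
    by (simp only: sum.distrib sum_subtractf sum_distrib_right vdot_def)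
  finally show ?thesis
    by (simp add: lap_form_eq[OF assms] power2_eq_square algebra_simps)
qed

lemma symm_shifted_laplacian: "symm n a \<Longrightarrow> symm n (shifted_laplacian n c a)"
  by (simp add: symm_def shifted_laplacian_def)

text \<open>The worst case is c and all weights equal to -\<eta>, where the J parts cancel and the
  form is 1 - n \<eta> times the squared length.\<close>

lemma coercive_shifted_laplacian:
  assumes a: "symm n a" and c: "\<bar>c\<bar> \<le> \<eta>" and bound: "\<And>i j. \<lbrakk>i < n; j < n\<rbrakk> \<Longrightarrow> \<bar>a i j\<bar> \<le> \<eta>"
  shows "coercive n (1 - real n * \<eta>) (shifted_laplacian n c a)"
  unfolding coercive_def
proof (intro conjI allI)
  fix v
  have "lap_form n (\<lambda>_ _. - \<eta>) v \<le> lap_form n a v"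
    unfolding lap_form_def using bound
    by (intro divide_right_mono sum_mono mult_right_mono) (auto simp: abs_le_iff minus_le_iff)
  moreover have "lap_form n (\<lambda>_ _. - \<eta>) v = \<eta> * (\<Sum>i<n. v i)\<^sup>2 - real n * \<eta> * vdot n v v"
  proof -
    have "(\<Sum>i<n. \<Sum>j<n. - \<eta> * v i * v j) = - \<eta> * (\<Sum>i<n. v i)\<^sup>2"
      unfolding power2_eq_square sum_product by (simp add: sum_distrib_left mult_ac sum_negf)
    moreover have "(\<Sum>i<n. \<Sum>j<n. - \<eta> * (v i)\<^sup>2) = - real n * \<eta> * vdot n v v"
      by (simp add: vdot_def sum_distrib_left power2_eq_square sum_negf mult_ac)
    ultimately show ?thesis by (simp add: lap_form_eq symm_def)
  qed
  moreover have "- \<eta> * (\<Sum>i<n. v i)\<^sup>2 \<le> c * (\<Sum>i<n. v i)\<^sup>2"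
    using c by (intro mult_right_mono) auto
  ultimately show "(1 - real n * \<eta>) * vdot n v v \<le> vdot n v (matvec n (shifted_laplacian n c a) v)"
    unfolding vdot_shifted_laplacian[OF a] by (simp add: algebra_simps)
qed (rule symm_shifted_laplacian[OF a])

lemma trace_pow_scalar:
  assumes "\<And>i j. \<lbrakk>i < n; j < n\<rbrakk> \<Longrightarrow> A i j = (if i = j then d else 0)"
  shows "trace_pow n A k = real n * d ^ k"
proof -
  have "matpow_vec n A k v i = d ^ k * v i" if "i < n" for i v
    using that
  proof (induction k arbitrary: i)
    case (Suc k)
    have "matpow_vec n A (Suc k) v i = (\<Sum>j<n. if i = j then d * (d ^ k * v j) else 0)"
      unfolding matpow_vec_Suc matvec_def using Suc assms by (intro sum.cong) auto
    then show ?case using Suc.prems by simp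
  qed simp
  then show ?thesis by (simp add: trace_pow_def unit_vec_def)
qed

section \<open>Optimality in the semidefinite program\<close>

lemma psd_form_Suc:
  fixes v :: "nat \<Rightarrow> real"
  assumes "\<And>i. i < n \<Longrightarrow> X i n = X n i"
  shows "(\<Sum>i<Suc n. \<Sum>j<Suc n. v i * X i j * v j)
    = (\<Sum>i<n. \<Sum>j<n. v i * X i j * v j) + 2 * v n * (\<Sum>i<n. v i * X i n) + (v n)\<^sup>2 * X n n"
proof -
  have "(\<Sum>i<n. v i * X i n * v n) = v n * (\<Sum>i<n. v i * X i n)"
    by (simp add: sum_distrib_left mult_ac)
  moreover have "(\<Sum>j<n. v n * X n j * v j) = v n * (\<Sum>i<n. v i * X i n)"
    using assms by (auto simp: sum_distrib_left mult_ac intro!: sum.cong)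
  ultimately show ?thesis by (simp add: sum.distrib power2_eq_square algebra_simps)
qed

text \<open>
  By induction through the Schur complement of the last diagonal entry; if that entry vanishes then so
  does its row, and division by zero leaves the remaining block unchanged.
\<close>

lemma psd_gram:
  assumes "psd n X"
  shows "\<exists>U. \<forall>i<n. \<forall>j<n. X i j = (\<Sum>k<n. U k i * U k j)"
  using assms
proof (induction n arbitrary: X)
  case (Suc n)
  define \<alpha> where "\<alpha> = X n n"
  have sym: "X i j = X j i" if "i < Suc n" "j < Suc n" for i j
    using Suc.prems that unfolding psd_def by blast
  have form: "0 \<le> (\<Sum>i<n. \<Sum>j<n. v i * X i j * v j) + 2 * v n * (\<Sum>i<n. v i * X i n) + (v n)\<^sup>2 * \<alpha>" for v
  proof -
    have "0 \<le> (\<Sum>i<Suc n. \<Sum>j<Suc n. v i * X i j * v j)"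
      using Suc.prems unfolding psd_def by blast
    then show ?thesis
      using psd_form_Suc[of n X v] sym by (simp add: \<alpha>_def del: sum.lessThan_Suc)
  qed
  have \<alpha>: "0 \<le> \<alpha>" using form[of "\<lambda>i. if i = n then 1 else 0"] by (simp add: \<alpha>_def)
  have zero: "X i n = 0" if "\<alpha> = 0" "i < n" for i
  proof (rule ccontr)
    assume nz: "X i n \<noteq> 0"
    \<comment> \<open>Chosen so that the form at e_i + t e_n, which is X_ii + 2 t X_in when \<alpha>
      = 0, equals -1.\<close>
    define t where "t = - (X i i + 1) / (2 * X i n)"
    define v where "v = (\<lambda>k. if k = i then 1 else if k = n then t else (0::real))"
    have "(\<Sum>k<n. v k * X k n) = (\<Sum>k<n. if k = i then X i n else 0)"
      using that by (intro sum.cong) (auto simp: v_def)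
    moreover have "(\<Sum>k<n. \<Sum>j<n. v k * X k j * v j) = (\<Sum>k<n. if k = i then X i i else 0)"
    proof (rule sum.cong)
      fix k assume "k \<in> {..<n}"
      have "(\<Sum>j<n. v k * X k j * v j) = (\<Sum>j<n. if j = i then v k * X k i else 0)"
        by (intro sum.cong) (auto simp: v_def)
      then show "(\<Sum>j<n. v k * X k j * v j) = (if k = i then X i i else 0)"
        using that \<open>k \<in> {..<n}\<close> by (auto simp: v_def)
    qed simp
    ultimately show False
      using form[of v] that nz by (auto simp: v_def t_def field_simps)
  qed
  have "psd n (\<lambda>i j. X i j - X i n * X j n / \<alpha>)"
    unfolding psd_def
  proof (intro conjI allI impI)
    fix v :: "nat \<Rightarrow> real"
    define \<beta> where "\<beta> = (\<Sum>i<n. v i * X i n)"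
    \<comment> \<open>Completing the square: this last coordinate minimises the form when \<alpha> >
      0. For \<alpha> = 0 it is 0, and so is the correction \<beta>^2 / \<alpha>.\<close>
    define w where "w = v(n := - \<beta> / \<alpha>)"
    have "(\<Sum>i<n. \<Sum>j<n. v i * (X i j - X i n * X j n / \<alpha>) * v j)
      = (\<Sum>i<n. \<Sum>j<n. v i * X i j * v j) - (\<Sum>i<n. \<Sum>j<n. (v i * X i n) * (v j * X j n)) / \<alpha>"
      by (simp add: sum_subtractf sum_divide_distrib algebra_simps)
    also have "(\<Sum>i<n. \<Sum>j<n. (v i * X i n) * (v j * X j n)) = \<beta>\<^sup>2"
      by (simp add: \<beta>_def power2_eq_square sum_product)
    also have "(\<Sum>i<n. \<Sum>j<n. v i * X i j * v j) - \<beta>\<^sup>2 / \<alpha>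
      = (\<Sum>i<n. \<Sum>j<n. w i * X i j * w j) + 2 * w n * (\<Sum>i<n. w i * X i n) + (w n)\<^sup>2 * \<alpha>"
    proof -
      have w: "(\<Sum>i<n. \<Sum>j<n. w i * X i j * w j) = (\<Sum>i<n. \<Sum>j<n. v i * X i j * v j)"
        "(\<Sum>i<n. w i * X i n) = \<beta>" "w n = - \<beta> / \<alpha>"
        by (auto simp: w_def \<beta>_def intro!: sum.cong)
      show ?thesis unfolding w by (cases "\<alpha> = 0") (simp_all add: power2_eq_square field_simps)
    qed
    also have "0 \<le> \<dots>" by (rule form)
    finally show "0 \<le> (\<Sum>i<n. \<Sum>j<n. v i * (X i j - X i n * X j n / \<alpha>) * v j)" .
  qed (use sym in auto)
  from Suc.IH[OF this] obtain U where
    U: "\<And>i j. \<lbrakk>i < n; j < n\<rbrakk> \<Longrightarrow> X i j - X i n * X j n / \<alpha> = (\<Sum>k<n. U k i * U k j)"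
    by blast
  \<comment> \<open>The Gram vectors of the Schur complement get the last coordinate 0, and one new
    row restores the subtracted rank-one term; for \<alpha> = 0 that row is zero.\<close>
  define V where "V = (\<lambda>k i. if k < n then (if i < n then U k i else 0) else X i n / sqrt \<alpha>)"
  have "X i j = (\<Sum>k<Suc n. V k i * V k j)" if ij: "i < Suc n" "j < Suc n" for i j
  proof -
    have last: "V n i * V n j = X i n * X j n / \<alpha>"
      using \<alpha> by (simp add: V_def)
    consider "i < n" "j < n" | "i = n \<or> j = n" using ij by linarith
    then show ?thesis
    proof cases
      case 1
      then have "(\<Sum>k<n. V k i * V k j) = (\<Sum>k<n. U k i * U k j)"
        by (intro sum.cong) (auto simp: V_def)
      then show ?thesis using U[OF 1] last by simp
    next
      case 2
      then have "(\<Sum>k<n. V k i * V k j) = 0" by (intro sum.neutral) (auto simp: V_def)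
      moreover have "X i j = X i n * X j n / \<alpha>"
      proof (cases "\<alpha> = 0")
        case True
        then have "X k n = 0" if "k < Suc n" for k
          using zero that by (auto simp: \<alpha>_def less_Suc_eq)
        then show ?thesis using 2 ij sym by auto
      next
        case False
        then show ?thesis using 2 ij sym by (auto simp: \<alpha>_def)
      qed
      ultimately show ?thesis using last by simp
    qed
  qed
  then show ?case by blast
qed simp

text \<open>The form sees only differences of coordinates, so the mean may be subtracted from
  v.\<close>

lemma lap_form_pos_or_const:
  assumes pos: "\<And>v. \<lbrakk>(\<Sum>i<n. v i) = 0; \<exists>i<n. v i \<noteq> 0\<rbrakk> \<Longrightarrow> 0 < lap_form n a v"
  shows "0 < lap_form n a v \<or> (\<exists>\<mu>. \<forall>i<n. v i = \<mu>)"
proof -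
  define \<mu> where "\<mu> = (\<Sum>i<n. v i) / real n"
  have "lap_form n a v = lap_form n a (\<lambda>i. v i - \<mu>)" by (simp add: lap_form_def)
  moreover have "(\<Sum>i<n. v i - \<mu>) = 0" by (cases "n = 0") (simp_all add: sum_subtractf \<mu>_def)
  ultimately show ?thesis using pos[of "\<lambda>i. v i - \<mu>"] by auto
qed

lemma lap_form_const: "(\<And>i. i < n \<Longrightarrow> v i = \<mu>) \<Longrightarrow> lap_form n a v = 0"
  by (simp add: lap_form_def)

text \<open>Write X as a Gram matrix and multiply its rows by g to get vectors v_k. The unit
  diagonal makes the degree part of the Laplacian forms sum to the objective at gg^T, so the
  objective at X falls short by exactly the sum of the forms at the v_k.\<close>

lemma sdp_unique_opt_if_lap_form_pos:
  fixes W :: "nat \<Rightarrow> nat \<Rightarrow> real" and g :: "nat \<Rightarrow> real"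
  defines "a \<equiv> \<lambda>i j. W i j * g i * g j"
  assumes g: "\<And>i. g i * g i = 1" and a: "symm n a"
    and pos: "\<And>v. \<lbrakk>(\<Sum>i<n. v i) = 0; \<exists>i<n. v i \<noteq> 0\<rbrakk> \<Longrightarrow> 0 < lap_form n a v"
  shows "sdp_unique_opt n W (\<lambda>i j. g i * g j)"
  unfolding sdp_unique_opt_def
proof (intro conjI allI impI)
  have "(\<Sum>i<n. \<Sum>j<n. v i * (g i * g j) * v j) = (\<Sum>i<n. v i * g i)\<^sup>2" for v
    unfolding power2_eq_square sum_product by (simp add: mult_ac)
  then show "sdp_feasible n (\<lambda>i j. g i * g j)"
    by (simp add: sdp_feasible_def psd_def g)
next
  fix X assume "sdp_feasible n X \<and> \<not> mat_eq n X (\<lambda>i j. g i * g j)"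
  then have X: "psd n X" "\<And>i. i < n \<Longrightarrow> X i i = 1" and neq: "\<not> mat_eq n X (\<lambda>i j. g i * g j)"
    by (auto simp: sdp_feasible_def)
  obtain U where U: "\<And>i j. \<lbrakk>i < n; j < n\<rbrakk> \<Longrightarrow> X i j = (\<Sum>k<n. U k i * U k j)"
    using psd_gram[OF X(1)] by blast
  define v where "v = (\<lambda>k i. g i * U k i)"
  have gg: "g i * (g i * z) = z" for i z by (simp add: g mult.assoc[symmetric])
  have nn: "0 \<le> lap_form n a (v k)" for k
    using lap_form_pos_or_const[OF pos, of "v k"] lap_form_const[of n "v k"] by (metis less_imp_le order_refl)
  have "mat_trace_prod n W X = (\<Sum>i<n. \<Sum>j<n. \<Sum>k<n. a i j * v k i * v k j)"
    unfolding mat_trace_prod_def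
    by (intro sum.cong refl) (simp add: U a_def v_def sum_distrib_left mult_ac gg)
  also have "\<dots> = (\<Sum>i<n. \<Sum>k<n. \<Sum>j<n. a i j * v k i * v k j)"
    by (intro sum.cong refl sum.swap)
  also have "\<dots> = (\<Sum>k<n. \<Sum>i<n. \<Sum>j<n. a i j * v k i * v k j)"
    by (rule sum.swap)
  also have "\<dots> = (\<Sum>k<n. (\<Sum>i<n. \<Sum>j<n. a i j * (v k i)\<^sup>2) - lap_form n a (v k))"
    by (simp add: lap_form_eq[OF a])
  also have "\<dots> = (\<Sum>k<n. \<Sum>i<n. \<Sum>j<n. a i j * (v k i)\<^sup>2) - (\<Sum>k<n. lap_form n a (v k))"
    by (rule sum_subtractf)
  also have "(\<Sum>k<n. \<Sum>i<n. \<Sum>j<n. a i j * (v k i)\<^sup>2) = (\<Sum>i<n. \<Sum>k<n. \<Sum>j<n. a i j * (v k i)\<^sup>2)"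
    by (rule sum.swap)
  also have "\<dots> = (\<Sum>i<n. \<Sum>j<n. \<Sum>k<n. a i j * (v k i)\<^sup>2)"
    by (intro sum.cong refl sum.swap)
  also have "\<dots> = (\<Sum>i<n. \<Sum>j<n. a i j)"
  proof (intro sum.cong refl)
    fix i j assume "i \<in> {..<n}"
    then have "(\<Sum>k<n. (v k i)\<^sup>2) = 1"
      using U[of i i] X(2)[of i] by (simp add: v_def power2_eq_square mult_ac gg)
    then show "(\<Sum>k<n. a i j * (v k i)\<^sup>2) = a i j"
      by (simp add: sum_distrib_left[symmetric])
  qed
  also have "\<dots> = mat_trace_prod n W (\<lambda>i j. g i * g j)"
    by (simp add: mat_trace_prod_def a_def mult_ac)
  finally have tr: "mat_trace_prod n W X
    = mat_trace_prod n W (\<lambda>i j. g i * g j) - (\<Sum>k<n. lap_form n a (v k))" .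
  \<comment> \<open>If no form were positive, all v_k would be constant and X a multiple of gg^T;
    the unit diagonal makes the factor 1.\<close>
  have "\<exists>k<n. 0 < lap_form n a (v k)"
  proof (rule ccontr)
    assume "\<not> ?thesis"
    then have "\<forall>k<n. \<exists>\<mu>. \<forall>i<n. v k i = \<mu>"
      using lap_form_pos_or_const[OF pos] by blast
    then obtain \<mu> where \<mu>: "\<And>k i. \<lbrakk>k < n; i < n\<rbrakk> \<Longrightarrow> v k i = \<mu> k" by metis
    have U\<mu>: "U k i = g i * \<mu> k" if "k < n" "i < n" for k i
      using \<mu>[OF that] by (metis v_def gg)
    have Xg: "X i j = g i * g j * (\<Sum>k<n. \<mu> k * \<mu> k)" if "i < n" "j < n" for i j
      using that by (simp add: U U\<mu> sum_distrib_left mult_ac)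
    have "X i j = g i * g j" if "i < n" "j < n" for i j
      using Xg[OF that] Xg[of i i] X(2)[of i] that by (simp add: g)
    then show False using neq by (simp add: mat_eq_def)
  qed
  then have "0 < (\<Sum>k<n. lap_form n a (v k))"
    using nn by (auto intro: sum_pos2)
  then show "mat_trace_prod n W X < mat_trace_prod n W (\<lambda>i j. g i * g j)" using tr by simp
qed

section \<open>Replacing random edges by a constant\<close>

definition pair_coeff :: "(nat \<times> nat \<Rightarrow> real) \<Rightarrow> nat \<Rightarrow> nat \<Rightarrow> real" where
  "pair_coeff s i j = (if i = j then 0 else s (min i j, max i j))"

definition edge_vec :: "nat \<times> nat \<Rightarrow> nat \<Rightarrow> real" where
  "edge_vec e i = (if i = fst e then 1 else if i = snd e then -1 else 0)"

text \<open>The entry of W on an edge after conjugation with g, where the contribution of x cancels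
  and only the noise remains.\<close>

definition edge_sign :: "bool \<times> bool \<Rightarrow> real" where
  "edge_sign y = (if fst y then (if snd y then -1 else 1) else 0)"

definition potential :: "nat \<Rightarrow> real \<Rightarrow> nat \<Rightarrow> (nat \<times> nat \<Rightarrow> real) \<Rightarrow> real" where
  "potential n c N s = trace_pow n (shifted_laplacian n c (pair_coeff s)) N"

lemma symm_pair_coeff: "symm n (pair_coeff s)"
  by (simp add: symm_def pair_coeff_def min.commute max.commute)

lemma vdot_edge_vec:
  assumes "e \<in> vpairs n"
  shows "vdot n (edge_vec e) (edge_vec e) = 2"
proof -
  obtain i j where e: "e = (i, j)" "i < j" "j < n" using assms by (auto simp: vpairs_def)
  have "vdot n (edge_vec e) (edge_vec e) = (\<Sum>l<n. (if l = i then 1 else 0) + (if l = j then 1 else 0))"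
    unfolding vdot_def by (intro sum.cong) (use e in \<open>auto simp: edge_vec_def\<close>)
  then show ?thesis using e by (simp add: sum.distrib)
qed

lemma pair_coeff_upd:
  assumes "i < j"
  shows "pair_coeff (s((i, j) := t)) u w
    = pair_coeff (s((i, j) := 0)) u w + (if (u = i \<and> w = j) \<or> (u = j \<and> w = i) then t else 0)"
  using assms by (auto simp: pair_coeff_def min_def max_def)

text \<open>A weight t on {i, j} adds t to the two diagonal entries and -t to the two off-diagonal
  ones, which is t b b^T for b = e_i - e_j.\<close>

lemma shifted_laplacian_upd:
  assumes "e \<in> vpairs n"
  shows "shifted_laplacian n c (pair_coeff (s(e := t)))
    = rank_one_update (shifted_laplacian n c (pair_coeff (s(e := 0)))) (edge_vec e) t"
proof (intro ext)
  fix u w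
  obtain i j where e: "e = (i, j)" "i < j" "j < n" using assms by (auto simp: vpairs_def)
  let ?a = "pair_coeff (s(e := 0))"
  have "(\<Sum>l<n. pair_coeff (s(e := t)) u l)
    = (\<Sum>l<n. ?a u l + (if u = i then (if l = j then t else 0) else if u = j then (if l = i then t else 0) else 0))"
    unfolding e(1) by (intro sum.cong refl, subst pair_coeff_upd[OF e(2)]) (use e in auto)
  also have "\<dots> = (\<Sum>l<n. ?a u l) + (if u = i \<or> u = j then t else 0)"
    using e by (simp add: sum.distrib)
  finally have row: "(\<Sum>l<n. pair_coeff (s(e := t)) u l) = (\<Sum>l<n. ?a u l) + (if u = i \<or> u = j then t else 0)" .
  show "shifted_laplacian n c (pair_coeff (s(e := t))) u w
    = rank_one_update (shifted_laplacian n c ?a) (edge_vec e) t u w"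
    unfolding shifted_laplacian_def rank_one_update_def row
    using e pair_coeff_upd[OF e(2), of s t u w] by (auto simp: edge_vec_def)
qed

text \<open>One lower bound serves all intermediate matrices, in which some edges are still random
  and others already constant.\<close>

lemma coercive_potential_matrix:
  assumes "\<bar>c\<bar> \<le> \<eta>" and "\<And>e. \<bar>s e\<bar> \<le> \<eta>"
  shows "coercive n (1 - real n * \<eta>) (shifted_laplacian n c (pair_coeff s))"
proof -
  have "0 \<le> \<eta>" using assms(1) by linarith
  then show ?thesis
    using assms by (intro coercive_shifted_laplacian symm_pair_coeff) (auto simp: pair_coeff_def)
qed

text \<open>The constant c is the mean of (exp(\<kappa> \<xi>) - 1) / \<kappa>, so averaging the
  exponential upper bound gives the tangent at 0 evaluated at c, which convexity puts below the
  potential at c. The 2 in \<kappa> is the squared length of \<open>edge_vec e\<close>.\<close>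

lemma potential_edge_step:
  fixes D :: "('b :: finite) pmf" and \<xi> :: "'b \<Rightarrow> real"
  assumes e: "e \<in> vpairs n" and k: "0 < k" and m: "m = 1 - real n * \<eta>" "0 < m"
    and \<kappa>: "\<kappa> = 2 * real k / m"
    and c: "c = measure_pmf.expectation D (\<lambda>y. (exp (\<kappa> * \<xi> y) - 1) / \<kappa>)" "\<bar>c\<bar> \<le> \<eta>"
    and s: "\<And>e. \<bar>s e\<bar> \<le> \<eta>" and \<xi>: "\<And>y. \<bar>\<xi> y\<bar> \<le> \<eta>"
  shows "measure_pmf.expectation D (\<lambda>y. potential n c (Suc k) (s(e := \<xi> y)))
    \<le> potential n c (Suc k) (s(e := c))"
proof -
  let ?A = "shifted_laplacian n c (pair_coeff (s(e := 0)))"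
  let ?\<phi> = "\<lambda>t. potential n c (Suc k) (s(e := t))"
  define h where "h = real (Suc k) * vdot n (edge_vec e) (matpow_vec n (rank_one_update ?A (edge_vec e) 0) k (edge_vec e))"
  have co: "coercive n m (rank_one_update ?A (edge_vec e) t)" if "\<bar>t\<bar> \<le> \<eta>" for t
    unfolding shifted_laplacian_upd[OF e, symmetric] m
    using that s c(2) by (intro coercive_potential_matrix) auto
  have up: "?\<phi> t \<le> ?\<phi> 0 + h * ((exp (\<kappa> * t) - 1) / \<kappa>)" and lo: "?\<phi> 0 + h * t \<le> ?\<phi> t"
    if "\<bar>t\<bar> \<le> \<eta>" for t
    using trace_pow_rank_one_bounds[OF symm_shifted_laplacian[OF symm_pair_coeff] m(2) _ k co that]
    by (simp_all add: vdot_edge_vec[OF e] h_def \<kappa> potential_def shifted_laplacian_upd[OF e, of c s, symmetric] mult.commute)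
  have int: "integrable (measure_pmf D) f" for f :: "'b \<Rightarrow> real"
    by (rule integrable_measure_pmf_finite) simp
  have "measure_pmf.expectation D (\<lambda>y. ?\<phi> (\<xi> y))
    \<le> measure_pmf.expectation D (\<lambda>y. ?\<phi> 0 + h * ((exp (\<kappa> * \<xi> y) - 1) / \<kappa>))"
    by (rule integral_mono[OF int int up[OF \<xi>]])
  also have "\<dots> = ?\<phi> 0 + h * c"
    by (subst Bochner_Integration.integral_add[OF int int]) (simp add: c(1))
  also have "\<dots> \<le> ?\<phi> c" by (rule lo[OF c(2)])
  finally show ?thesis .
qed

text \<open>Condition on the value at a new key e, replace the other keys by c with that value held
  fixed, and then average over e. The background s varies in the induction because it absorbs the
  fixed value.\<close>

lemma Pi_pmf_expectation_step:
  fixes D :: "('b :: finite) pmf" and F :: "('a \<Rightarrow> real) \<Rightarrow> real"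
  assumes step: "\<And>k s. \<lbrakk>k \<in> S; \<And>l. \<bar>s l\<bar> \<le> \<eta>\<rbrakk> \<Longrightarrow>
      measure_pmf.expectation D (\<lambda>y. F (s(k := \<xi> y))) \<le> F (s(k := c))"
    and c: "\<bar>c\<bar> \<le> \<eta>" and \<xi>: "\<And>y. \<bar>\<xi> y\<bar> \<le> \<eta>" and "finite S"
    and s: "\<And>l. \<bar>s l\<bar> \<le> \<eta>"
  shows "measure_pmf.expectation (Pi_pmf S d (\<lambda>_. D)) (\<lambda>f. F (\<lambda>k. if k \<in> S then \<xi> (f k) else s k))
    \<le> F (\<lambda>k. if k \<in> S then c else s k)"
  using \<open>finite S\<close> step s
proof (induction S arbitrary: s)
  case (insert e S)
  let ?P = "Pi_pmf S d (\<lambda>_. D)"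
  let ?G = "\<lambda>f. F (\<lambda>k. if k \<in> insert e S then \<xi> (f k) else s k)"
  define s' where "s' = (\<lambda>k. if k \<in> S then c else s k)"
  have fin: "finite (set_pmf ?P)"
    using insert.hyps(1) by (simp add: set_Pi_pmf finite_PiE_dflt)
  have "measure_pmf.expectation (Pi_pmf (insert e S) d (\<lambda>_. D)) ?G
    = (\<Sum>y\<in>UNIV. pmf D y * measure_pmf.expectation ?P (\<lambda>f. ?G (f(e := y))))"
  proof -
    have "Pi_pmf (insert e S) d (\<lambda>_. D) = bind_pmf D (\<lambda>y. map_pmf (\<lambda>f. f(e := y)) ?P)"
      using insert.hyps by (simp add: Pi_pmf_insert' map_pmf_def)
    then show ?thesis
      using fin by (simp add: pmf_expectation_bind[of UNIV])
  qed
  also have "\<dots> \<le> (\<Sum>y\<in>UNIV. pmf D y * F (s'(e := \<xi> y)))"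
  proof (intro sum_mono mult_left_mono)
    fix y
    have eq1: "(\<lambda>k. if k \<in> insert e S then \<xi> ((f(e := y)) k) else s k)
      = (\<lambda>k. if k \<in> S then \<xi> (f k) else (s(e := \<xi> y)) k)" for f
      using insert.hyps(2) by auto
    have eq2: "(\<lambda>k. if k \<in> S then c else (s(e := \<xi> y)) k) = s'(e := \<xi> y)"
      using insert.hyps(2) by (auto simp: s'_def)
    have "measure_pmf.expectation ?P (\<lambda>f. F (\<lambda>k. if k \<in> S then \<xi> (f k) else (s(e := \<xi> y)) k))
      \<le> F (\<lambda>k. if k \<in> S then c else (s(e := \<xi> y)) k)"
      using insert.prems \<xi> by (intro insert.IH) auto
    then show "measure_pmf.expectation ?P (\<lambda>f. ?G (f(e := y))) \<le> F (s'(e := \<xi> y))"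
      unfolding eq1 eq2 .
  qed simp
  also have "\<dots> = measure_pmf.expectation D (\<lambda>y. F (s'(e := \<xi> y)))"
    by (subst integral_measure_pmf[of UNIV]) auto
  also have "\<dots> \<le> F (s'(e := c))"
    using insert.prems c by (intro insert.prems(1)) (auto simp: s'_def)
  also have "s'(e := c) = (\<lambda>k. if k \<in> insert e S then c else s k)"
    by (auto simp: s'_def)
  finally show ?case .
qed simp

section \<open>From the random graph model to the potential\<close>

lemma Wmat_gvec: "Wmat x \<omega> i j * gvec x i * gvec x j = pair_coeff (\<lambda>e. edge_sign (\<omega> e)) i j"
  by (auto simp: Wmat_def gvec_def pair_coeff_def edge_sign_def Let_def)

lemma gvec_square: "gvec x i * gvec x i = 1"
  by (simp add: gvec_def)

lemma finite_vpairs: "finite (vpairs n)"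
  by (rule finite_subset[of _ "{..<n} \<times> {..<n}"]) (auto simp: vpairs_def)

lemma expectation_edge:
  assumes "0 \<le> p" "p \<le> 1" "0 \<le> eps" "eps \<le> 1"
  shows "measure_pmf.expectation (pair_pmf (bernoulli_pmf p) (bernoulli_pmf eps)) f
    = p * (eps * f (True, True) + (1 - eps) * f (True, False))
      + (1 - p) * (eps * f (False, True) + (1 - eps) * (f (False, False) :: real))"
proof -
  have U: "(UNIV :: (bool \<times> bool) set) = {(True, True), (True, False), (False, True), (False, False)}"
    by (auto simp: UNIV_bool)
  show ?thesis
    by (subst integral_measure_pmf[of UNIV]) (use assms in \<open>auto simp: U pmf_pair algebra_simps\<close>)
qed

text \<open>Failure yields a nonzero v with coordinate sum 0 and a nonpositive form. The factor
  -\<tau> reverses the sign and the c J part vanishes on v, so the Rayleigh quotient at v is at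
  least 1.\<close>

lemma sdp_failure_potential_ge_1:
  assumes m: "0 < 1 - real n * \<eta>" and c: "\<bar>c\<bar> \<le> \<eta>" and s: "\<And>e. \<bar>s e\<bar> \<le> \<eta>" and "0 \<le> \<tau>"
    and s\<omega>: "\<And>e. e \<in> vpairs n \<Longrightarrow> s e = - \<tau> * edge_sign (\<omega> e)"
    and fail: "\<not> sdp_unique_opt n (Wmat x \<omega>) (\<lambda>i j. gvec x i * gvec x j)"
  shows "1 \<le> potential n c (k + k) s"
proof -
  let ?a = "pair_coeff (\<lambda>e. edge_sign (\<omega> e))"
  have a: "(\<lambda>i j. Wmat x \<omega> i j * gvec x i * gvec x j) = ?a"
    by (simp add: Wmat_gvec fun_eq_iff)
  obtain v where v: "(\<Sum>i<n. v i) = 0" "\<exists>i<n. v i \<noteq> 0" "lap_form n ?a v \<le> 0"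
    using sdp_unique_opt_if_lap_form_pos[of "gvec x" n "Wmat x \<omega>", unfolded a, OF gvec_square symm_pair_coeff]
      fail by (meson not_less)
  have "pair_coeff s i j = - \<tau> * ?a i j" if "i < n" "j < n" for i j
    using that s\<omega>[of "(min i j, max i j)"] by (auto simp: pair_coeff_def vpairs_def)
  then have "lap_form n (pair_coeff s) v = - \<tau> * lap_form n ?a v"
    by (simp add: lap_form_def sum_distrib_left sum_negf mult_ac)
  then have "0 \<le> lap_form n (pair_coeff s) v"
    using v(3) \<open>0 \<le> \<tau>\<close> by (simp add: mult_nonneg_nonpos)
  then have "vdot n v v \<le> vdot n v (matvec n (shifted_laplacian n c (pair_coeff s)) v)"
    by (simp add: vdot_shifted_laplacian[OF symm_pair_coeff] v(1))
  moreover have "0 < vdot n v v" using v(2) vdot_self_pos by blast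
  ultimately show ?thesis
    unfolding potential_def
    using trace_pow_ge_1[OF coercive_potential_matrix[of c \<eta> s, OF c s] m] by blast
qed

text \<open>The complete graph with all weights c has Laplacian c (n I - J), whose J part cancels
  the shift c J.\<close>

lemma potential_const:
  "potential n c N (\<lambda>_. c) = real n * (1 + real n * c) ^ N"
  unfolding potential_def
proof (rule trace_pow_scalar)
  fix i j :: nat assume "i < n" "j < n"
  have "(\<Sum>l<n. pair_coeff (\<lambda>_. c) i l) = (\<Sum>l\<in>{..<n} - {i}. c)"
    by (intro sum.mono_neutral_cong_right) (auto simp: pair_coeff_def)
  then have "(\<Sum>l<n. pair_coeff (\<lambda>_. c) i l) = real n * c - c"
    using \<open>i < n\<close> by (simp add: of_nat_diff algebra_simps)
  then show "shifted_laplacian n c (pair_coeff (\<lambda>_. c)) i j = (if i = j then 1 + real n * c else 0)"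
    by (auto simp: shifted_laplacian_def pair_coeff_def)
qed

section \<open>Choice of parameters and the failure probability\<close>

theorem theorem4:
  fixes n :: nat and p eps \<delta> :: real and x :: "nat \<Rightarrow> bool"
  assumes "n \<ge> 2" and "0 \<le> p" and "p \<le> 1"
    and "0 \<le> eps" and "eps < 1/2" and "\<delta> > 0"
    and "(real (n - 1) * p) / ln (real n) \<ge>
           (1 + \<delta>) * (4 / (1 - 2 * eps)^2 + 4 / (3 * (1 - 2 * eps)))"
  shows "measure_pmf.prob (er_noise_pmf n p eps)
           {\<omega>. sdp_unique_opt n (Wmat x \<omega>) (\<lambda>i j. gvec x i * gvec x j)}
         \<ge> 1 - real n powr (- \<delta>)"
proof -
  define r where "r = 1 - 2 * eps"
  \<comment> \<open>The exponent \<open>Suc k\<close> = 2 n^2 is even, as the trace bounds require,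
    and large enough for n \<eta> \<le> 1/n. Then n m \<ge> n - 1, which matches the n - 1 in
    d.\<close>
  define k where "k = 2 * n\<^sup>2 - 1"
  \<comment> \<open>A bound for 1/\<kappa> = m/(2k) that does not mention m, since m is defined from
    it; it also bounds c and all weights \<xi>.\<close>
  define \<eta> where "\<eta> = 1 / (2 * real k)"
  define m where "m = 1 - real n * \<eta>"
  define \<kappa> where "\<kappa> = 2 * real k / m"
  \<comment> \<open>With this \<open>\<tau>\<close> a flipped edge has \<open>exp (\<kappa> * \<xi>) = 1 + r\<close> and a correct one \<open>1 / (1 + r)\<close>;
    their mean with weights \<open>(1 - r) / 2\<close> and \<open>(1 + r) / 2\<close> is \<open>1 - r\<^sup>2 / 2\<close>.\<close>
  define \<tau> where "\<tau> = ln (1 + r) / \<kappa>"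
  \<comment> \<open>Absent edges contribute exp(0) - 1 = 0, so the mean of exp(\<kappa> \<xi>) - 1
    is -p r^2 / 2.\<close>
  define c where "c = - (p * r\<^sup>2) / (2 * \<kappa>)"
  define \<xi> where "\<xi> y = - \<tau> * edge_sign y" for y
  have r: "0 < r" "r \<le> 1" using assms(4,5) by (auto simp: r_def)
  have n2: "4 \<le> n\<^sup>2" using power_mono[OF assms(1), of 2] by simp
  have Suck: "Suc k = n\<^sup>2 + n\<^sup>2" and kpos: "0 < k" using n2 by (auto simp: k_def)
  have rk: "real k = 2 * (real n)\<^sup>2 - 1" using n2 by (simp add: k_def of_nat_diff)
  have \<eta>: "0 < \<eta>" using kpos by (simp add: \<eta>_def)
  have n\<eta>: "real n * \<eta> \<le> 1 / real n"
  proof -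
    have "(real n)\<^sup>2 \<le> 2 * real k" using rk n2 by (simp flip: of_nat_power)
    then show ?thesis using assms(1) kpos by (simp add: \<eta>_def field_simps power2_eq_square)
  qed
  have n\<eta>_half: "real n * \<eta> \<le> 1 / 2"
    by (rule order_trans[OF n\<eta>]) (use assms(1) in \<open>simp add: field_simps\<close>)
  then have m: "0 < m" "m \<le> 1" using \<eta> by (auto simp: m_def)
  have \<kappa>: "0 < \<kappa>" using m kpos by (simp add: \<kappa>_def)
  have \<kappa>\<eta>: "1 / \<kappa> \<le> \<eta>" using m kpos by (simp add: \<kappa>_def \<eta>_def field_simps)
  have \<tau>: "0 \<le> \<tau>" "\<tau> \<le> \<eta>"
  proof -
    show "0 \<le> \<tau>" using r \<kappa> by (simp add: \<tau>_def)
    have "\<tau> \<le> 1 / \<kappa>"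
      unfolding \<tau>_def using r \<kappa> ln_add_one_self_le_self[of r] by (intro divide_right_mono) auto
    then show "\<tau> \<le> \<eta>" using \<kappa>\<eta> by simp
  qed
  have c: "\<bar>c\<bar> \<le> \<eta>" "c \<le> 0"
  proof -
    have "p * r\<^sup>2 \<le> 1" using r assms(2,3) by (simp add: mult_le_one power_le_one)
    then have "p * r\<^sup>2 / (2 * \<kappa>) \<le> 1 / \<kappa>" using \<kappa> by (simp add: field_simps)
    moreover have nn: "0 \<le> p * r\<^sup>2 / (2 * \<kappa>)" using assms(2) \<kappa> by simp
    moreover have "c = - (p * r\<^sup>2 / (2 * \<kappa>))" by (simp add: c_def)
    ultimately show "\<bar>c\<bar> \<le> \<eta>" using \<kappa>\<eta> by simp
    show "c \<le> 0" using nn by (simp add: c_def)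
  qed
  have \<xi>: "\<bar>\<xi> y\<bar> \<le> \<eta>" for y using \<tau> \<eta> by (simp add: \<xi>_def edge_sign_def)
  let ?D = "pair_pmf (bernoulli_pmf p) (bernoulli_pmf eps)"
  have Ec: "c = measure_pmf.expectation ?D (\<lambda>y. (exp (\<kappa> * \<xi> y) - 1) / \<kappa>)"
  proof -
    have "\<kappa> * \<tau> = ln (1 + r)" using \<kappa> by (simp add: \<tau>_def)
    then have vals: "exp (\<kappa> * \<xi> (True, True)) = 1 + r" "exp (\<kappa> * \<xi> (True, False)) = 1 / (1 + r)"
      "exp (\<kappa> * \<xi> (False, b)) = 1" for b
      using r by (simp_all add: \<xi>_def edge_sign_def exp_minus inverse_eq_divide)
    have "eps * r + (1 - eps) * (1 / (1 + r) - 1) = - r\<^sup>2 / 2"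
    proof -
      have eps: "eps = (1 - r) / 2" by (simp add: r_def)
      show ?thesis unfolding eps using r by (simp add: field_simps power2_eq_square)
    qed
    then have "c = p * (eps * r + (1 - eps) * (1 / (1 + r) - 1)) / \<kappa>"
      by (simp add: c_def)
    also have "\<dots> = p * (eps * (r / \<kappa>) + (1 - eps) * ((1 / (1 + r) - 1) / \<kappa>))"
      by (simp add: add_divide_distrib distrib_left)
    finally show ?thesis
      using assms(2-5) by (subst expectation_edge) (simp_all add: vals)
  qed
  let ?P = "er_noise_pmf n p eps"
  \<comment> \<open>The value c off \<open>vpairs n\<close> makes the weights constant once all
    edges are replaced, as \<open>potential_const\<close> expects.\<close>
  let ?s = "\<lambda>\<omega> e. if e \<in> vpairs n then \<xi> (\<omega> e) else c"
  let ?F = "potential n c (Suc k)"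
  have "measure_pmf.expectation ?P (\<lambda>\<omega>. ?F (?s \<omega>)) \<le> ?F (\<lambda>e. if e \<in> vpairs n then c else c)"
    unfolding er_noise_pmf_def
  proof (rule Pi_pmf_expectation_step[where \<eta> = \<eta>])
    fix e and s :: "nat \<times> nat \<Rightarrow> real" assume "e \<in> vpairs n" and "\<And>l. \<bar>s l\<bar> \<le> \<eta>"
    then show "measure_pmf.expectation ?D (\<lambda>y. ?F (s(e := \<xi> y))) \<le> ?F (s(e := c))"
      by (intro potential_edge_step[OF _ kpos m_def m(1) \<kappa>_def Ec c(1) _ \<xi>])
  qed (use c \<xi> finite_vpairs in auto)
  also have "\<dots> = real n * (1 + real n * c) ^ Suc k"
    by (simp only: if_cancel potential_const)
  also have "\<dots> \<le> real n * exp (- ((1 + \<delta>) * ln (real n)))"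
  proof (rule mult_left_mono)
    \<comment> \<open>Ensures a nonnegative base, so that 1 + y \<le> exp y can be raised to a
      power.\<close>
    have "real n * \<bar>c\<bar> \<le> 1 / 2"
      using c(1) n\<eta>_half mult_left_mono[of "\<bar>c\<bar>" \<eta> "real n"] by linarith
    then have "0 \<le> 1 + real n * c" using c(2) by (simp add: abs_of_nonpos)
    then have "(1 + real n * c) ^ Suc k \<le> exp (real n * c) ^ Suc k"
      by (intro power_mono exp_ge_add_one_self)
    also have "\<dots> = exp (real (Suc k) * (real n * c))" by (rule exp_of_nat_mult[symmetric])
    also have "\<dots> \<le> exp (- ((1 + \<delta>) * ln (real n)))"
    proof -
      have ln: "0 < ln (real n)" using assms(1) by simp
      have "(1 + \<delta>) * (4 / r\<^sup>2) \<le> (1 + \<delta>) * (4 / r\<^sup>2 + 4 / (3 * r))"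
        using r assms(6) by (intro mult_left_mono) auto
      also have "\<dots> \<le> (real n - 1) * p / ln (real n)"
        using assms(1,7) by (simp add: r_def of_nat_diff)
      finally have "(1 + \<delta>) * ln (real n) \<le> (real n - 1) * (p * r\<^sup>2) / 4"
        using ln r by (simp add: field_simps)
      also have "\<dots> \<le> (real n * m) * (p * r\<^sup>2) / 4"
      proof -
        have "real n - 1 \<le> real n * m"
          using n\<eta> assms(1) by (simp add: m_def field_simps)
        then show ?thesis using assms(2) by (intro divide_right_mono mult_right_mono) auto
      qed
      \<comment> \<open>As \<kappa> = 2k/m, the factor k cancels in k n c = -n m p r^2 / 4.\<close>
      also have "\<dots> = - (real k * (real n * c))"
        using m kpos by (simp add: c_def \<kappa>_def field_simps)
      also have "\<dots> \<le> - (real (Suc k) * (real n * c))"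
        using c(2) by (simp add: algebra_simps mult_nonpos_nonneg)
      finally show ?thesis by simp
    qed
    finally show "(1 + real n * c) ^ Suc k \<le> exp (- ((1 + \<delta>) * ln (real n)))" .
  qed simp
  also have "\<dots> = real n powr (- \<delta>)"
  proof -
    have "real n = exp (ln (real n))" using assms(1) by simp
    then have "real n * exp (- ((1 + \<delta>) * ln (real n))) = exp (ln (real n) + - ((1 + \<delta>) * ln (real n)))"
      by (simp only: exp_add)
    then show ?thesis using assms(1) by (simp add: powr_def algebra_simps)
  qed
  finally have E: "measure_pmf.expectation ?P (\<lambda>\<omega>. ?F (?s \<omega>)) \<le> real n powr (- \<delta>)" .
  let ?good = "{\<omega>. sdp_unique_opt n (Wmat x \<omega>) (\<lambda>i j. gvec x i * gvec x j)}"
  have fin: "finite (set_pmf ?P)"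
    by (simp add: er_noise_pmf_def set_Pi_pmf finite_vpairs finite_PiE_dflt)
  \<comment> \<open>Markov's inequality in pointwise form: the potential is nonnegative everywhere
    and at least 1 on failure.\<close>
  have "indicator (- ?good) \<omega> \<le> ?F (?s \<omega>)" for \<omega>
  proof (cases "\<omega> \<in> ?good")
    case True
    then show ?thesis
      using trace_pow_even_nonneg[OF symm_shifted_laplacian[OF symm_pair_coeff]]
      by (simp add: potential_def Suck)
  next
    case False
    then have "1 \<le> potential n c (n\<^sup>2 + n\<^sup>2) (?s \<omega>)"
      using m(1) c(1) \<xi> \<tau>(1)
      by (intro sdp_failure_potential_ge_1[where \<eta> = \<eta> and \<tau> = \<tau> and \<omega> = \<omega> and x = x])
         (auto simp: m_def \<xi>_def)
    then show ?thesis using False by (simp add: Suck)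
  qed
  then have "measure_pmf.expectation ?P (indicator (- ?good)) \<le> measure_pmf.expectation ?P (\<lambda>\<omega>. ?F (?s \<omega>))"
    by (intro integral_mono integrable_measure_pmf_finite fin)
  then have "measure_pmf.prob ?P (- ?good) \<le> real n powr (- \<delta>)"
    using E by simp
  then show ?thesis
    using measure_pmf.prob_compl[of ?good ?P] by (simp add: Compl_eq_Diff_UNIV)
qed

end
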